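(* Let $\mathcal M:z=z(u,v)$, $(u,v)\in\mathcal D$, be a time-like W-surface in $\mathbb R^3_1$ and let $(u,v)$ be natural principal parameters on $\mathcal M$. Then $(u,v)$ are natural principal parameters for all parallel time-like surfaces $\overline{\mathcal M}(a)$, $a=\mathrm{const}\neq0$, of $\mathcal M$.
   Context: $\mathbb R^3_1$ is $\mathbb R^3$ with the flat metric $\langle x,y\rangle=x_1y_1+x_2y_2-x_3y_3$. Functions are assumed sufficiently smooth. For a time-like surface $z=z(u,v)$ let $l$ be the unit normal field, $\langle l,l\rangle=1$, and $E=\langle z_u,z_u\rangle<0$, $F=\langle z_u,z_v\rangle$, $G=\langle z_v,z_v\rangle>0$, $L=\langle l,z_{uu}\rangle$, $M=\langle l,z_{uv}\rangle$, $N=\langle l,z_{vv}\rangle$. Parameters are principal if $F=M=0$; then the principal curvatures are $\nu_1=L/E$, $\nu_2=N/G$, and all surfaces considered have distinct real principal curvatures, $\nu_1\neq\nu_2$. The surface is a Weingarten surface (W-surface) with Weingarten functions $f,g$ if $f(\nu),g(\nu)$, $\nu\in\mathcal I$ (an interval), are differentiable functions with $f-g\ne0$, $f'g'\neq0$, and there is a function $\nu=\nu(u,v)$ such that $\nu_1=f(\nu)$, $\nu_2=g(\nu)$. Principal parameters $(u,v)$ on a Weingarten surface are natural principal if both functions $\sqrt{-E}\,\exp\left(\int\frac{f'd\nu}{f-g}\right)$ and $\sqrt G\,\exp\left(\int\frac{g'd\nu}{g-f}\right)$ (antiderivatives in $\nu$, evaluated at $\nu=\nu(u,v)$) are constant.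 For a constant $a\neq0$ the parallel surface $\overline{\mathcal M}(a)$ is given by $\bar z(u,v)=z(u,v)+a\,l(u,v)$, points where $(1-a\nu_1)(1-a\nu_2)=0$ being excluded. It is again a time-like surface, its unit normal is taken to be $\bar l=\varepsilon l$ with $\varepsilon=\mathrm{sign}\,(1-a\nu_1)(1-a\nu_2)$, and it is a Weingarten surface with respect to the same function $\nu(u,v)$, with Weingarten functions $\bar f=\frac{\varepsilon f}{1-af}$, $\bar g=\frac{\varepsilon g}{1-ag}$. *)

theory Defs
  imports "HOL-Analysis.Analysis"
begin

definition lorentz :: "real^3 \<Rightarrow> real^3 \<Rightarrow> real" where
  "lorentz x y = x$1 * y$1 + x$2 * y$2 - x$3 * y$3"

definition diff_u :: "(real \<times> real \<Rightarrow> 'a::real_normed_vector) \<Rightarrow> real \<times> real \<Rightarrow> 'a" where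
  "diff_u h p = vector_derivative (\<lambda>u. h (u, snd p)) (at (fst p))"

definition diff_v :: "(real \<times> real \<Rightarrow> 'a::real_normed_vector) \<Rightarrow> real \<times> real \<Rightarrow> 'a" where
  "diff_v h p = vector_derivative (\<lambda>v. h (fst p, v)) (at (snd p))"

text \<open>Class \<open>C\<^sup>n\<close> on an open set of parameters.\<close>

fun class_C :: "nat \<Rightarrow> (real \<times> real) set \<Rightarrow> (real \<times> real \<Rightarrow> 'a::real_normed_vector) \<Rightarrow> bool" where
  "class_C 0 D h \<longleftrightarrow> continuous_on D h"
| "class_C (Suc n) D h \<longleftrightarrow>
     h differentiable_on D \<and> class_C n D (diff_u h) \<and> class_C n D (diff_v h)"

text \<open>A surface is represented by its parametrization \<open>z\<close> together with the chosen unit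
  normal field \<open>l\<close>.\<close>

definition coeff_E :: "(real \<times> real \<Rightarrow> real^3) \<Rightarrow> real \<times> real \<Rightarrow> real" where
  "coeff_E z p = lorentz (diff_u z p) (diff_u z p)"

definition coeff_F :: "(real \<times> real \<Rightarrow> real^3) \<Rightarrow> real \<times> real \<Rightarrow> real" where
  "coeff_F z p = lorentz (diff_u z p) (diff_v z p)"

definition coeff_G :: "(real \<times> real \<Rightarrow> real^3) \<Rightarrow> real \<times> real \<Rightarrow> real" where
  "coeff_G z p = lorentz (diff_v z p) (diff_v z p)"

definition coeff_L ::
  "(real \<times> real \<Rightarrow> real^3) \<Rightarrow> (real \<times> real \<Rightarrow> real^3) \<Rightarrow> real \<times> real \<Rightarrow> real" where
  "coeff_L z l p = lorentz (l p) (diff_u (diff_u z) p)"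

definition coeff_M ::
  "(real \<times> real \<Rightarrow> real^3) \<Rightarrow> (real \<times> real \<Rightarrow> real^3) \<Rightarrow> real \<times> real \<Rightarrow> real" where
  "coeff_M z l p = lorentz (l p) (diff_v (diff_u z) p)"

definition coeff_N ::
  "(real \<times> real \<Rightarrow> real^3) \<Rightarrow> (real \<times> real \<Rightarrow> real^3) \<Rightarrow> real \<times> real \<Rightarrow> real" where
  "coeff_N z l p = lorentz (l p) (diff_v (diff_v z) p)"

text \<open>The two functions below are the principal curvatures only in principal parameters.\<close>

definition nu1 ::
  "(real \<times> real \<Rightarrow> real^3) \<Rightarrow> (real \<times> real \<Rightarrow> real^3) \<Rightarrow> real \<times> real \<Rightarrow> real" where
  "nu1 z l p = coeff_L z l p / coeff_E z p"

definition nu2 ::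
  "(real \<times> real \<Rightarrow> real^3) \<Rightarrow> (real \<times> real \<Rightarrow> real^3) \<Rightarrow> real \<times> real \<Rightarrow> real" where
  "nu2 z l p = coeff_N z l p / coeff_G z p"

text \<open>A time-like surface of class \<open>C\<^sup>n\<close> (meant for \<open>n \<ge> 2\<close>). The parameter set is open, but not
  required to be connected: removing the excluded points of a parallel surface may
  disconnect it.\<close>

definition timelike_surface ::
  "nat \<Rightarrow> (real \<times> real) set \<Rightarrow> (real \<times> real \<Rightarrow> real^3) \<Rightarrow> (real \<times> real \<Rightarrow> real^3) \<Rightarrow> bool" where
  "timelike_surface n D z l \<longleftrightarrow>
     open D \<and> class_C n D z \<and> class_C (n - 1) D l \<and>
     (\<forall>p\<in>D. coeff_E z p < 0 \<and> coeff_G z p > 0 \<and>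
        lorentz (l p) (l p) = 1 \<and> lorentz (l p) (diff_u z p) = 0 \<and> lorentz (l p) (diff_v z p) = 0)"

definition principal_parameters ::
  "nat \<Rightarrow> (real \<times> real) set \<Rightarrow> (real \<times> real \<Rightarrow> real^3) \<Rightarrow> (real \<times> real \<Rightarrow> real^3) \<Rightarrow> bool" where
  "principal_parameters n D z l \<longleftrightarrow>
     timelike_surface n D z l \<and>
     (\<forall>p\<in>D. coeff_F z p = 0 \<and> coeff_M z l p = 0 \<and> nu1 z l p \<noteq> nu2 z l p)"

text \<open>\<open>I\<close> is a nondegenerate interval, possibly containing end points, at which derivatives are
  one-sided.\<close>

definition weingarten_surface ::
  "nat \<Rightarrow> (real \<times> real) set \<Rightarrow> (real \<times> real \<Rightarrow> real^3) \<Rightarrow> (real \<times> real \<Rightarrow> real^3) \<Rightarrow>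
   real set \<Rightarrow> (real \<Rightarrow> real) \<Rightarrow> (real \<Rightarrow> real) \<Rightarrow> (real \<times> real \<Rightarrow> real) \<Rightarrow> bool" where
  "weingarten_surface n D z l I f g \<nu> \<longleftrightarrow>
     principal_parameters n D z l \<and>
     is_interval I \<and> interior I \<noteq> {} \<and>
     f differentiable_on I \<and> g differentiable_on I \<and>
     (\<forall>t\<in>I. f t - g t \<noteq> 0 \<and>
        vector_derivative f (at t within I) * vector_derivative g (at t within I) \<noteq> 0) \<and>
     (\<forall>p\<in>D. \<nu> p \<in> I \<and> nu1 z l p = f (\<nu> p) \<and> nu2 z l p = g (\<nu> p))"

text \<open>The indefinite integrals are antiderivatives \<open>P\<close>, \<open>Q\<close> on the interval \<open>I\<close>. They are unique up
  to an additive constant, so the choice of \<open>P\<close> and \<open>Q\<close> does not affect constancy.\<close>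

definition natural_principal_parameters ::
  "nat \<Rightarrow> (real \<times> real) set \<Rightarrow> (real \<times> real \<Rightarrow> real^3) \<Rightarrow> (real \<times> real \<Rightarrow> real^3) \<Rightarrow>
   real set \<Rightarrow> (real \<Rightarrow> real) \<Rightarrow> (real \<Rightarrow> real) \<Rightarrow> (real \<times> real \<Rightarrow> real) \<Rightarrow> bool" where
  "natural_principal_parameters n D z l I f g \<nu> \<longleftrightarrow>
     weingarten_surface n D z l I f g \<nu> \<and>
     (\<exists>P Q.
        (\<forall>t\<in>I. (P has_real_derivative vector_derivative f (at t within I) / (f t - g t)) (at t within I)) \<and>
        (\<forall>t\<in>I. (Q has_real_derivative vector_derivative g (at t within I) / (g t - f t)) (at t within I)) \<and>
        (\<lambda>p. sqrt (- coeff_E z p) * exp (P (\<nu> p))) constant_on D \<and>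
        (\<lambda>p. sqrt (coeff_G z p) * exp (Q (\<nu> p))) constant_on D)"

definition parallel_domain ::
  "real \<Rightarrow> (real \<times> real) set \<Rightarrow> (real \<times> real \<Rightarrow> real^3) \<Rightarrow> (real \<times> real \<Rightarrow> real^3) \<Rightarrow> (real \<times> real) set"
  where
  "parallel_domain a D z l = {p\<in>D. (1 - a * nu1 z l p) * (1 - a * nu2 z l p) \<noteq> 0}"

definition parallel_surface ::
  "real \<Rightarrow> (real \<times> real \<Rightarrow> real^3) \<Rightarrow> (real \<times> real \<Rightarrow> real^3) \<Rightarrow> real \<times> real \<Rightarrow> real^3" where
  "parallel_surface a z l p = z p + a *\<^sub>R l p"

definition parallel_normal ::
  "real \<Rightarrow> (real \<times> real \<Rightarrow> real^3) \<Rightarrow> (real \<times> real \<Rightarrow> real^3) \<Rightarrow> real \<times> real \<Rightarrow> real^3" where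
  "parallel_normal a z l p = sgn ((1 - a * nu1 z l p) * (1 - a * nu2 z l p)) *\<^sub>R l p"

text \<open>Removing from \<open>I\<close> the values of \<open>\<nu>\<close> of excluded points may split the interval; the parallel
  surface is then a Weingarten surface over each of the resulting intervals, i.e. over the
  connected components of \<open>parallel_interval\<close>.\<close>

definition parallel_interval ::
  "real \<Rightarrow> real set \<Rightarrow> (real \<Rightarrow> real) \<Rightarrow> (real \<Rightarrow> real) \<Rightarrow> real set" where
  "parallel_interval a I f g = {t\<in>I. (1 - a * f t) * (1 - a * g t) \<noteq> 0}"

definition parallel_sign :: "real \<Rightarrow> (real \<Rightarrow> real) \<Rightarrow> (real \<Rightarrow> real) \<Rightarrow> real \<Rightarrow> real" where
  "parallel_sign a f g t = sgn ((1 - a * f t) * (1 - a * g t))"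

definition parallel_f :: "real \<Rightarrow> (real \<Rightarrow> real) \<Rightarrow> (real \<Rightarrow> real) \<Rightarrow> real \<Rightarrow> real" where
  "parallel_f a f g t = parallel_sign a f g t * f t / (1 - a * f t)"

definition parallel_g :: "real \<Rightarrow> (real \<Rightarrow> real) \<Rightarrow> (real \<Rightarrow> real) \<Rightarrow> real \<Rightarrow> real" where
  "parallel_g a f g t = parallel_sign a f g t * g t / (1 - a * g t)"

end

theory Submission
  imports Defs
begin

text \<open>In principal parameters the Weingarten formulas \<open>l\<^sub>u = - \<nu>\<^sub>1 z\<^sub>u\<close>, \<open>l\<^sub>v = - \<nu>\<^sub>2 z\<^sub>v\<close> show that
  passing to \<open>z + a l\<close> multiplies \<open>z\<^sub>u\<close>, \<open>z\<^sub>v\<close> by \<open>1 - a \<nu>\<^sub>1\<close>, \<open>1 - a \<nu>\<^sub>2\<close>; so the parameters remain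
  principal and \<open>\<surd>(-E)\<close> acquires the factor \<open>\<bar>1 - a f\<bar>\<close>. On the other hand the new
  integrand is \<open>f' / (f - g) + a f' / (1 - a f)\<close>, whose antiderivative differs from the old one by
  \<open>- ln \<bar>1 - a f\<bar>\<close>. After exponentiation the two factors cancel; likewise for \<open>G\<close> and \<open>g\<close>.\<close>

section \<open>The Lorentz form: boundedness and nondegeneracy\<close>

text \<open>This makes the product rule and the continuity of products available for the
  form.\<close>

interpretation lorentz: bounded_bilinear lorentz
proof
  show "\<exists>K. \<forall>x y. norm (lorentz x y) \<le> norm x * norm y * K"
  proof (intro exI allI)
    fix x y :: "real^3"
    have "lorentz x y = inner x y - 2 * (x$3 * y$3)"
      by (simp add: lorentz_def inner_vec_def sum_3)
    moreover have "\<bar>inner x y\<bar> \<le> norm x * norm y"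
      by (rule Cauchy_Schwarz_ineq2)
    moreover have "\<bar>x$3 * y$3\<bar> \<le> norm x * norm y"
      unfolding abs_mult by (intro mult_mono component_le_norm_cart) auto
    \<comment> \<open>The constant 3 is 1 for the Euclidean product plus 2 for the correction in the
      third coordinate.\<close>
    ultimately show "norm (lorentz x y) \<le> norm x * norm y * 3"
      by simp
  qed
qed (simp_all add: lorentz_def algebra_simps)

lemma lorentz_commute: "lorentz x y = lorentz y x"
  by (simp add: lorentz_def algebra_simps)

text \<open>The Gram matrix of \<open>x\<close>, \<open>y\<close>, \<open>n\<close> is diagonal with
  nonzero entries, so the vectors form a basis and only zero is orthogonal to all three. Applied to
  the two tangent vectors and the normal, this identifies a vector by its products with the moving
  frame.\<close>

lemma lorentz_orthogonal_basis_zero: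
  assumes nz: "lorentz x x \<noteq> 0" "lorentz y y \<noteq> 0" "lorentz n n \<noteq> 0"
    and orth: "lorentz x y = 0" "lorentz x n = 0" "lorentz y n = 0"
    and w: "lorentz w x = 0" "lorentz w y = 0" "lorentz w n = 0"
  shows "w = 0"
proof -
  define d where "d = x$1 * (y$2 * n$3 - y$3 * n$2) - x$2 * (y$1 * n$3 - y$3 * n$1)
    + x$3 * (y$1 * n$2 - y$2 * n$1)"
  \<comment> \<open>The form has matrix diag(1, 1, -1), so the Gram determinant of \<open>x\<close>,
    \<open>y\<close>, \<open>n\<close> is minus the square of their determinant
    \<open>d\<close>.\<close>
  have "d\<^sup>2 = - (lorentz x x * lorentz y y * lorentz n n
      + 2 * lorentz x y * lorentz y n * lorentz x n
      - lorentz x x * (lorentz y n)\<^sup>2 - lorentz y y * (lorentz x n)\<^sup>2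
      - lorentz n n * (lorentz x y)\<^sup>2)"
    unfolding d_def lorentz_def by algebra
  then have "d\<^sup>2 = - (lorentz x x * lorentz y y * lorentz n n)"
    using orth by simp
  then have "d \<noteq> 0"
    using nz by auto
  \<comment> \<open>Cramer's rule for the unknowns \<open>w$1\<close>, \<open>w$2\<close>,
    \<open>- w$3\<close>; the sign of the last one reverses the signs in the third identity.\<close>
  moreover have "w$1 * d = lorentz w x * (y$2 * n$3 - y$3 * n$2)
      - lorentz w y * (x$2 * n$3 - x$3 * n$2) + lorentz w n * (x$2 * y$3 - x$3 * y$2)"
    "w$2 * d = - lorentz w x * (y$1 * n$3 - y$3 * n$1)
      + lorentz w y * (x$1 * n$3 - x$3 * n$1) - lorentz w n * (x$1 * y$3 - x$3 * y$1)"
    "w$3 * d = - lorentz w x * (y$1 * n$2 - y$2 * n$1)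
      + lorentz w y * (x$1 * n$2 - x$2 * n$1) - lorentz w n * (x$1 * y$2 - x$2 * y$1)"
    unfolding d_def lorentz_def by algebra+
  ultimately show ?thesis
    using w by (simp add: vec_eq_iff forall_3)
qed

section \<open>Partial derivatives along coordinate lines\<close>

text \<open>Differentiability at \<open>p\<close> passes to the slice through \<open>p\<close>, so
  \<open>vector_derivative\<close> returns a genuine derivative there and not an arbitrary
  value.\<close>

lemma diff_u_works:
  assumes "h differentiable at p"
  shows "((\<lambda>u. h (u, snd p)) has_vector_derivative diff_u h p) (at (fst p))"
proof -
  have "(\<lambda>u. h (u, snd p)) differentiable at (fst p)"
    by (rule differentiable_compose[where f = h]) (use assms in \<open>auto intro!: derivative_intros\<close>)
  then show ?thesis
    unfolding diff_u_def by (simp add: vector_derivative_works)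
qed

lemma diff_v_works:
  assumes "h differentiable at p"
  shows "((\<lambda>v. h (fst p, v)) has_vector_derivative diff_v h p) (at (snd p))"
proof -
  have "(\<lambda>v. h (fst p, v)) differentiable at (snd p)"
    by (rule differentiable_compose[where f = h]) (use assms in \<open>auto intro!: derivative_intros\<close>)
  then show ?thesis
    unfolding diff_v_def by (simp add: vector_derivative_works)
qed

lemma eventually_slices:
  assumes "open D" "p \<in> D"
  shows "\<forall>\<^sub>F u in nhds (fst p). (u, snd p) \<in> D" "\<forall>\<^sub>F v in nhds (snd p). (fst p, v) \<in> D"
proof -
  have "open ((\<lambda>u. (u, snd p)) -` D)" "open ((\<lambda>v. (fst p, v)) -` D)"
    using assms(1) by (auto intro!: open_vimage continuous_intros)
  then show "\<forall>\<^sub>F u in nhds (fst p). (u, snd p) \<in> D" "\<forall>\<^sub>F v in nhds (snd p). (fst p, v) \<in> D"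
    using assms(2) by (auto simp: eventually_nhds)
qed

text \<open>Near \<open>p\<close> both slices stay in the open set \<open>D\<close>. Identities
  known only on \<open>D\<close> can therefore be differentiated.\<close>

lemma diff_cong:
  assumes "open D" "p \<in> D" "\<And>q. q \<in> D \<Longrightarrow> h q = k q"
  shows "diff_u h p = diff_u k p" "diff_v h p = diff_v k p"
proof -
  have "\<forall>\<^sub>F u in nhds (fst p). h (u, snd p) = k (u, snd p)"
    "\<forall>\<^sub>F v in nhds (snd p). h (fst p, v) = k (fst p, v)"
    using eventually_slices[OF assms(1,2)] assms(3) by (auto elim: eventually_mono)
  then show "diff_u h p = diff_u k p" "diff_v h p = diff_v k p"
    unfolding diff_u_def diff_v_def by (simp_all add: vector_derivative_cong_eq)
qed

lemma diff_linear:
  assumes "h differentiable at p" "k differentiable at p"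
  shows "diff_u (\<lambda>q. h q + c *\<^sub>R k q) p = diff_u h p + c *\<^sub>R diff_u k p"
    "diff_v (\<lambda>q. h q + c *\<^sub>R k q) p = diff_v h p + c *\<^sub>R diff_v k p"
proof -
  note lin = bounded_linear.has_vector_derivative[OF bounded_linear_scaleR_right[of c]]
  show "diff_u (\<lambda>q. h q + c *\<^sub>R k q) p = diff_u h p + c *\<^sub>R diff_u k p"
    unfolding diff_u_def[of "\<lambda>q. h q + c *\<^sub>R k q"]
    by (intro vector_derivative_at has_vector_derivative_add lin diff_u_works[OF assms(1)]
        diff_u_works[OF assms(2)])
  show "diff_v (\<lambda>q. h q + c *\<^sub>R k q) p = diff_v h p + c *\<^sub>R diff_v k p"
    unfolding diff_v_def[of "\<lambda>q. h q + c *\<^sub>R k q"]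
    by (intro vector_derivative_at has_vector_derivative_add lin diff_v_works[OF assms(1)]
        diff_v_works[OF assms(2)])
qed

lemma diff_bounded_linear:
  assumes "bounded_linear A" "h differentiable at p"
  shows "diff_u (\<lambda>q. A (h q)) p = A (diff_u h p)" "diff_v (\<lambda>q. A (h q)) p = A (diff_v h p)"
proof -
  note lin = bounded_linear.has_vector_derivative[OF assms(1)]
  show "diff_u (\<lambda>q. A (h q)) p = A (diff_u h p)"
    unfolding diff_u_def[of "\<lambda>q. A (h q)"]
    by (rule vector_derivative_at[OF lin[OF diff_u_works[OF assms(2)]]])
  show "diff_v (\<lambda>q. A (h q)) p = A (diff_v h p)"
    unfolding diff_v_def[of "\<lambda>q. A (h q)"]
    by (rule vector_derivative_at[OF lin[OF diff_v_works[OF assms(2)]]])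
qed

lemmas diff_scaleR = diff_bounded_linear[OF bounded_linear_scaleR_right]

lemmas diff_nth = diff_bounded_linear[OF bounded_linear_vec_nth]

section \<open>Functions of class \<open>C^n\<close>\<close>

lemma class_C_differentiable:
  assumes "class_C n D h" "n > 0" "open D" "p \<in> D"
  shows "h differentiable at p"
proof -
  have "h differentiable_on D"
    using assms(1,2) by (cases n) simp_all
  then show ?thesis
    using assms(3,4) by (simp add: differentiable_on_eq_differentiable_at)
qed

lemma class_C_continuous: "class_C n D h \<Longrightarrow> continuous_on D h"
  by (cases n) (auto intro: differentiable_imp_continuous_on)

lemma class_C_Suc_imp: "class_C (Suc n) D h \<Longrightarrow> class_C n D h"
proof (induction n arbitrary: h)
  case 0
  then show ?case
    by (simp add: differentiable_imp_continuous_on)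
next
  case (Suc n)
  then have h: "h differentiable_on D" "class_C (Suc n) D (diff_u h)" "class_C (Suc n) D (diff_v h)"
    by (simp_all only: class_C.simps(2)[of "Suc n"])
  show ?case
    using h(1) Suc.IH[OF h(2)] Suc.IH[OF h(3)] by simp
qed

lemma class_C_mono: "class_C n D h \<Longrightarrow> m \<le> n \<Longrightarrow> class_C m D h"
proof (induction n)
  case (Suc n)
  then show ?case
    using class_C_Suc_imp[of n D h] by (cases "m = Suc n") (simp_all del: class_C.simps)
qed simp

lemma class_C_subset: "class_C n D h \<Longrightarrow> D' \<subseteq> D \<Longrightarrow> class_C n D' h"
proof (induction n arbitrary: h)
  case 0
  then show ?case
    by (simp add: continuous_on_subset[of D])
next
  case (Suc n)
  then show ?case
    by (simp add: differentiable_on_subset[of h D])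
qed

text \<open>Functions are total, but only their values on the open set \<open>D\<close> matter. The
  inductions below need this because rules for partial derivatives of a combined function hold only
  on \<open>D\<close>.\<close>

lemma class_C_cong:
  assumes "open D" "\<And>q. q \<in> D \<Longrightarrow> h q = k q" "class_C n D h"
  shows "class_C n D k"
  using assms(2,3)
proof (induction n arbitrary: h k)
  case 0
  then show ?case
    using continuous_on_cong[of D D h k] by simp
next
  case (Suc n)
  have "k differentiable_on D"
    using Suc.prems unfolding class_C.simps differentiable_on_def differentiable_def
    by (metis has_derivative_transform)
  moreover have "diff_u h q = diff_u k q" "diff_v h q = diff_v k q" if "q \<in> D" for q
    using diff_cong[OF assms(1) that Suc.prems(1)] by simp_all
  then have "class_C n D (diff_u k)" "class_C n D (diff_v k)"
    using Suc.IH[of "diff_u h" "diff_u k"] Suc.IH[of "diff_v h" "diff_v k"] Suc.prems(2) by simp_all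
  ultimately show ?case
    by simp
qed

lemma class_C_linear:
  assumes "open D" "class_C n D h" "class_C n D k"
  shows "class_C n D (\<lambda>q. h q + c *\<^sub>R k q)"
  using assms(2,3)
proof (induction n arbitrary: h k)
  case 0
  then show ?case
    by (auto intro!: continuous_intros)
next
  case (Suc n)
  have d: "h differentiable at p" "k differentiable at p" if "p \<in> D" for p
    using Suc.prems that assms(1) class_C_differentiable by blast+
  have "class_C n D (diff_u (\<lambda>q. h q + c *\<^sub>R k q))"
    by (rule class_C_cong[OF assms(1) _ Suc.IH[of "diff_u h" "diff_u k"]])
      (use Suc.prems d in \<open>auto simp: diff_linear\<close>)
  moreover have "class_C n D (diff_v (\<lambda>q. h q + c *\<^sub>R k q))"
    by (rule class_C_cong[OF assms(1) _ Suc.IH[of "diff_v h" "diff_v k"]])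
      (use Suc.prems d in \<open>auto simp: diff_linear\<close>)
  ultimately show ?case
    using Suc.prems by (auto intro!: derivative_intros)
qed

lemma class_C_scaleR:
  assumes "open D" "class_C n D h"
  shows "class_C n D (\<lambda>q. c *\<^sub>R h q)"
proof -
  \<comment> \<open>Writing \<open>c = 1 + (c - 1)\<close> makes scaling a special case of
    \<open>class_C_linear\<close>.\<close>
  have "(\<lambda>q. h q + (c - 1) *\<^sub>R h q) = (\<lambda>q. c *\<^sub>R h q)"
    by (simp add: fun_eq_iff scaleR_diff_left)
  then show ?thesis
    using class_C_linear[OF assms(1) assms(2) assms(2), of "c - 1"] by simp
qed

section \<open>Symmetry of mixed partial derivatives\<close>

text \<open>Both mixed derivatives occur as values of the same second difference quotient.\<close>

lemma second_difference_uv: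
  fixes h :: "real \<times> real \<Rightarrow> real"
  assumes "class_C 2 D h" "open D" "s > 0" "{x..x+s} \<times> {y..y+s} \<subseteq> D"
  shows "\<exists>q \<in> {x..x+s} \<times> {y..y+s}.
    h (x+s, y+s) - h (x+s, y) - h (x, y+s) + h (x, y) = s * (s * diff_v (diff_u h) q)"
proof -
  have C: "class_C (Suc 1) D h" "class_C (Suc 0) D (diff_u h)"
    using assms(1) by (simp_all add: numeral_2_eq_2)
  have d: "((\<lambda>u. h (u, v)) has_real_derivative diff_u h (u, v)) (at u)"
    if "u \<in> {x..x+s}" "v \<in> {y..y+s}" for u v
    using diff_u_works[OF class_C_differentiable[OF C(1) _ assms(2)], of "(u, v)"]
      subsetD[OF assms(4), of "(u, v)"] that
    by (auto simp: has_real_derivative_iff_has_vector_derivative)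
  have dd: "((\<lambda>v. diff_u h (u, v)) has_real_derivative diff_v (diff_u h) (u, v)) (at v)"
    if "u \<in> {x..x+s}" "v \<in> {y..y+s}" for u v
    using diff_v_works[OF class_C_differentiable[OF C(2) _ assms(2)], of "(u, v)"]
      subsetD[OF assms(4), of "(u, v)"] that
    by (auto simp: has_real_derivative_iff_has_vector_derivative)
  \<comment> \<open>The mean value theorem is used twice: first in \<open>u\<close> for the
    difference between the two horizontal edges, then in \<open>v\<close> for
    \<open>diff_u h\<close> on the vertical line through the point found.\<close>
  obtain \<xi> where \<xi>: "x < \<xi>" "\<xi> < x + s"
    "(h (x+s, y+s) - h (x+s, y)) - (h (x, y+s) - h (x, y))
      = (x + s - x) * (diff_u h (\<xi>, y+s) - diff_u h (\<xi>, y))"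
    using MVT2[of x "x+s" "\<lambda>u. h (u, y+s) - h (u, y)" "\<lambda>u. diff_u h (u, y+s) - diff_u h (u, y)"]
      assms(3) d by (force intro!: DERIV_diff)
  obtain \<eta> where \<eta>: "y < \<eta>" "\<eta> < y + s"
    "diff_u h (\<xi>, y+s) - diff_u h (\<xi>, y) = (y + s - y) * diff_v (diff_u h) (\<xi>, \<eta>)"
    using MVT2[of y "y+s" "\<lambda>v. diff_u h (\<xi>, v)" "\<lambda>v. diff_v (diff_u h) (\<xi>, v)"]
      assms(3) dd \<xi> by force
  show ?thesis
    using \<xi> \<eta> by (intro bexI[of _ "(\<xi>, \<eta>)"]) auto
qed

lemma second_difference_vu:
  fixes h :: "real \<times> real \<Rightarrow> real"
  assumes "class_C 2 D h" "open D" "s > 0" "{x..x+s} \<times> {y..y+s} \<subseteq> D"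
  shows "\<exists>q \<in> {x..x+s} \<times> {y..y+s}.
    h (x+s, y+s) - h (x+s, y) - h (x, y+s) + h (x, y) = s * (s * diff_u (diff_v h) q)"
proof -
  have C: "class_C (Suc 1) D h" "class_C (Suc 0) D (diff_v h)"
    using assms(1) by (simp_all add: numeral_2_eq_2)
  have d: "((\<lambda>v. h (u, v)) has_real_derivative diff_v h (u, v)) (at v)"
    if "u \<in> {x..x+s}" "v \<in> {y..y+s}" for u v
    using diff_v_works[OF class_C_differentiable[OF C(1) _ assms(2)], of "(u, v)"]
      subsetD[OF assms(4), of "(u, v)"] that
    by (auto simp: has_real_derivative_iff_has_vector_derivative)
  have dd: "((\<lambda>u. diff_v h (u, v)) has_real_derivative diff_u (diff_v h) (u, v)) (at u)"
    if "u \<in> {x..x+s}" "v \<in> {y..y+s}" for u v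
    using diff_u_works[OF class_C_differentiable[OF C(2) _ assms(2)], of "(u, v)"]
      subsetD[OF assms(4), of "(u, v)"] that
    by (auto simp: has_real_derivative_iff_has_vector_derivative)
  \<comment> \<open>The same four corner values are now paired horizontally, so the mean value
    theorem in \<open>v\<close> comes first.\<close>
  obtain \<eta> where \<eta>: "y < \<eta>" "\<eta> < y + s"
    "(h (x+s, y+s) - h (x, y+s)) - (h (x+s, y) - h (x, y))
      = (y + s - y) * (diff_v h (x+s, \<eta>) - diff_v h (x, \<eta>))"
    using MVT2[of y "y+s" "\<lambda>v. h (x+s, v) - h (x, v)" "\<lambda>v. diff_v h (x+s, v) - diff_v h (x, v)"]
      assms(3) d by (force intro!: DERIV_diff)
  obtain \<xi> where \<xi>: "x < \<xi>" "\<xi> < x + s"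
    "diff_v h (x+s, \<eta>) - diff_v h (x, \<eta>) = (x + s - x) * diff_u (diff_v h) (\<xi>, \<eta>)"
    using MVT2[of x "x+s" "\<lambda>u. diff_v h (u, \<eta>)" "\<lambda>u. diff_u (diff_v h) (u, \<eta>)"]
      assms(3) dd \<eta> by force
  show ?thesis
    using \<xi> \<eta> by (intro bexI[of _ "(\<xi>, \<eta>)"]) auto
qed

lemma mixed_derivatives_real:
  fixes h :: "real \<times> real \<Rightarrow> real"
  assumes "class_C 2 D h" "open D" "p \<in> D"
  shows "diff_v (diff_u h) p = diff_u (diff_v h) p"
proof (rule ccontr)
  assume ne: "\<not> ?thesis"
  \<comment> \<open>With \<open>e\<close> half of the supposed gap, values within \<open>e\<close>
    of the two mixed derivatives at \<open>p\<close> cannot coincide.\<close>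
  define e where "e = \<bar>diff_v (diff_u h) p - diff_u (diff_v h) p\<bar> / 2"
  have e: "e > 0"
    using ne by (simp add: e_def)
  have "continuous_on D (diff_v (diff_u h))" "continuous_on D (diff_u (diff_v h))"
    using assms(1) by (simp_all add: numeral_2_eq_2)
  then have "isCont (diff_v (diff_u h)) p" "isCont (diff_u (diff_v h)) p"
    using assms(2,3) by (simp_all add: continuous_on_eq_continuous_at)
  then have "\<forall>\<^sub>F q in nhds p. q \<in> D \<and> dist (diff_v (diff_u h) q) (diff_v (diff_u h) p) < e
      \<and> dist (diff_u (diff_v h) q) (diff_u (diff_v h) p) < e"
    using e assms(2,3)
    by (intro eventually_conj eventually_nhds_in_open)
      (auto simp: continuous_at_eps_delta eventually_nhds_metric tendsto_iff)
  then obtain r where r: "r > 0" "\<And>q. dist q p < r \<Longrightarrow> q \<in> D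
      \<and> dist (diff_v (diff_u h) q) (diff_v (diff_u h) p) < e
      \<and> dist (diff_u (diff_v h) q) (diff_u (diff_v h) p) < e"
    by (auto simp: eventually_nhds_metric)
  \<comment> \<open>Points of the square with side \<open>r / 3\<close> have distance at most
    \<open>2 * r / 3 < r\<close> from \<open>p\<close>.\<close>
  define s where "s = r / 3"
  define R where "R = {fst p..fst p + s} \<times> {snd p..snd p + s}"
  have s: "s > 0"
    using r(1) by (simp add: s_def)
  have R: "dist q p < r" if "q \<in> R" for q
  proof -
    have "dist q p \<le> \<bar>fst q - fst p\<bar> + \<bar>snd q - snd p\<bar>"
      using sqrt_sum_squares_le_sum_abs[of "fst q - fst p" "snd q - snd p"]
      by (simp add: dist_prod_def dist_real_def)
    also have "\<dots> \<le> s + s"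
      using that by (auto simp: R_def)
    finally show ?thesis
      using r(1) by (simp add: s_def)
  qed
  then have "R \<subseteq> D"
    using r(2) by auto
  \<comment> \<open>Both expressions equal the second difference over the same square
    \<open>R\<close>.\<close>
  then obtain q q' where q: "q \<in> R" "q' \<in> R"
    and "s * (s * diff_v (diff_u h) q) = s * (s * diff_u (diff_v h) q')"
    using second_difference_uv[OF assms(1,2) s] second_difference_vu[OF assms(1,2) s]
    unfolding R_def by metis
  then have "diff_v (diff_u h) q = diff_u (diff_v h) q'"
    using s by simp
  moreover have "\<bar>diff_v (diff_u h) q - diff_v (diff_u h) p\<bar> < e"
    "\<bar>diff_u (diff_v h) q' - diff_u (diff_v h) p\<bar> < e"
    using r(2)[OF R[OF q(1)]] r(2)[OF R[OF q(2)]] by (simp_all add: dist_real_def)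
  moreover have "\<bar>diff_v (diff_u h) p - diff_u (diff_v h) p\<bar> = 2 * e"
    by (simp add: e_def)
  ultimately show False
    by linarith
qed

lemma class_C_nth:
  fixes h :: "real \<times> real \<Rightarrow> real^'n"
  assumes "open D" "class_C n D h"
  shows "class_C n D (\<lambda>q. h q $ i)"
  using assms(2)
proof (induction n arbitrary: h)
  case 0
  then show ?case
    by (auto intro!: continuous_intros)
next
  case (Suc n)
  have d: "h differentiable at p" if "p \<in> D" for p
    using Suc.prems that assms(1) class_C_differentiable by blast
  have "class_C n D (diff_u (\<lambda>q. h q $ i))"
    by (rule class_C_cong[OF assms(1) _ Suc.IH[of "diff_u h"]])
      (use Suc.prems d in \<open>auto simp: diff_nth\<close>)
  moreover have "class_C n D (diff_v (\<lambda>q. h q $ i))"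
    by (rule class_C_cong[OF assms(1) _ Suc.IH[of "diff_v h"]])
      (use Suc.prems d in \<open>auto simp: diff_nth\<close>)
  moreover have "(\<lambda>q. h q $ i) differentiable_on D"
    using Suc.prems unfolding class_C.simps differentiable_on_def differentiable_def
    by (blast intro: bounded_linear.has_derivative[OF bounded_linear_vec_nth])
  ultimately show ?case
    by simp
qed

text \<open>The mean value argument is restricted to real functions, so the vector case goes
  coordinate by coordinate.\<close>

lemma mixed_derivatives:
  fixes h :: "real \<times> real \<Rightarrow> real^'n"
  assumes "class_C 2 D h" "open D" "p \<in> D"
  shows "diff_v (diff_u h) p = diff_u (diff_v h) p"
proof -
  have C: "class_C (Suc 1) D h" "class_C (Suc 0) D (diff_u h)" "class_C (Suc 0) D (diff_v h)"
    using assms(1) by (simp_all add: numeral_2_eq_2)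
  note d = class_C_differentiable[OF C(1) _ assms(2)] class_C_differentiable[OF C(2) _ assms(2)]
    class_C_differentiable[OF C(3) _ assms(2)]
  have "diff_v (diff_u h) p $ i = diff_u (diff_v h) p $ i" for i
  proof -
    have "diff_v (diff_u h) p $ i = diff_v (\<lambda>q. diff_u h q $ i) p"
      using d assms(3) by (simp add: diff_nth)
    also have "\<dots> = diff_v (diff_u (\<lambda>q. h q $ i)) p"
      using d by (intro diff_cong[OF assms(2,3)]) (simp add: diff_nth)
    also have "\<dots> = diff_u (diff_v (\<lambda>q. h q $ i)) p"
      by (rule mixed_derivatives_real[OF class_C_nth[OF assms(2,1)] assms(2,3)])
    also have "\<dots> = diff_u (\<lambda>q. diff_v h q $ i) p"
      using d by (intro diff_cong[OF assms(2,3)]) (simp add: diff_nth)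
    also have "\<dots> = diff_u (diff_v h) p $ i"
      using d assms(3) by (simp add: diff_nth)
    finally show ?thesis .
  qed
  then show ?thesis
    by (simp add: vec_eq_iff)
qed

section \<open>Second fundamental form and Weingarten formulas\<close>

text \<open>The product rule applied to a constant product; it is used for the unit length of the
  normal and for its orthogonality to the tangent vectors.\<close>

lemma lorentz_constant_diff:
  assumes "open D" "p \<in> D" "h differentiable at p" "k differentiable at p"
    and "\<And>q. q \<in> D \<Longrightarrow> lorentz (h q) (k q) = c"
  shows "lorentz (h p) (diff_u k p) = - lorentz (diff_u h p) (k p)"
    "lorentz (h p) (diff_v k p) = - lorentz (diff_v h p) (k p)"
proof -
  have "diff_u (\<lambda>q. lorentz (h q) (k q)) p = lorentz (h p) (diff_u k p) + lorentz (diff_u h p) (k p)"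
    using lorentz.has_vector_derivative[OF diff_u_works[OF assms(3)] diff_u_works[OF assms(4)]]
    unfolding diff_u_def[of "\<lambda>q. lorentz (h q) (k q)"] by (simp add: vector_derivative_at)
  moreover have "diff_u (\<lambda>q. lorentz (h q) (k q)) p = diff_u (\<lambda>q. c) p"
    by (rule diff_cong[OF assms(1,2,5)])
  ultimately show "lorentz (h p) (diff_u k p) = - lorentz (diff_u h p) (k p)"
    by (simp add: diff_u_def)
  have "diff_v (\<lambda>q. lorentz (h q) (k q)) p = lorentz (h p) (diff_v k p) + lorentz (diff_v h p) (k p)"
    using lorentz.has_vector_derivative[OF diff_v_works[OF assms(3)] diff_v_works[OF assms(4)]]
    unfolding diff_v_def[of "\<lambda>q. lorentz (h q) (k q)"] by (simp add: vector_derivative_at)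
  moreover have "diff_v (\<lambda>q. lorentz (h q) (k q)) p = diff_v (\<lambda>q. c) p"
    by (rule diff_cong[OF assms(1,2,5)])
  ultimately show "lorentz (h p) (diff_v k p) = - lorentz (diff_v h p) (k p)"
    by (simp add: diff_v_def)
qed

lemma timelike_surface_differentiable:
  assumes "timelike_surface n D z l" "n \<ge> 2" "p \<in> D"
  shows "z differentiable at p" "diff_u z differentiable at p" "diff_v z differentiable at p"
    "l differentiable at p"
proof -
  obtain m where n: "n = Suc (Suc m)"
    using that[of "n - 2"] assms(2) by simp
  have "open D" and z: "class_C (Suc (Suc m)) D z" and l: "class_C (Suc m) D l"
    using assms(1) by (simp_all add: timelike_surface_def n del: class_C.simps)
  moreover have "class_C (Suc m) D (diff_u z)" "class_C (Suc m) D (diff_v z)"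
    using z by simp_all
  ultimately show "z differentiable at p" "diff_u z differentiable at p"
    "diff_v z differentiable at p" "l differentiable at p"
    using class_C_differentiable assms(3) zero_less_Suc by blast+
qed

text \<open>Differentiating the orthogonality of \<open>l\<close> to \<open>diff_u z\<close> and
  \<open>diff_v z\<close> moves one derivative onto \<open>l\<close>. The two expressions for
  \<open>coeff_M\<close> come from different orthogonality relations and are linked by the symmetry
  of mixed derivatives.\<close>

lemma second_form_eq:
  assumes S: "timelike_surface n D z l" and n: "n \<ge> 2" and p: "p \<in> D"
  shows "coeff_L z l p = - lorentz (diff_u l p) (diff_u z p)"
    "coeff_M z l p = - lorentz (diff_v l p) (diff_u z p)"
    "coeff_M z l p = - lorentz (diff_u l p) (diff_v z p)"
    "coeff_N z l p = - lorentz (diff_v l p) (diff_v z p)"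
proof -
  have D: "open D" and z: "class_C 2 D z"
    and orth: "\<And>q. q \<in> D \<Longrightarrow> lorentz (l q) (diff_u z q) = 0"
      "\<And>q. q \<in> D \<Longrightarrow> lorentz (l q) (diff_v z q) = 0"
    using S n class_C_mono by (auto simp: timelike_surface_def)
  note d = timelike_surface_differentiable[OF S n p]
  show "coeff_L z l p = - lorentz (diff_u l p) (diff_u z p)"
    "coeff_M z l p = - lorentz (diff_v l p) (diff_u z p)"
    "coeff_N z l p = - lorentz (diff_v l p) (diff_v z p)"
    unfolding coeff_L_def coeff_M_def coeff_N_def
    using lorentz_constant_diff[OF D p d(4) d(2) orth(1)]
      lorentz_constant_diff[OF D p d(4) d(3) orth(2)] by simp_all
  show "coeff_M z l p = - lorentz (diff_u l p) (diff_v z p)"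
    unfolding coeff_M_def mixed_derivatives[OF z D p]
    using lorentz_constant_diff[OF D p d(4) d(3) orth(2)] by simp
qed

text \<open>The difference of the two sides is orthogonal to the whole frame: to the tangent vectors
  by the values of the second form and \<open>F = M = 0\<close>, to \<open>l\<close> because
  \<open>l\<close> has constant length.\<close>

lemma weingarten_formulas:
  assumes P: "principal_parameters n D z l" and n: "n \<ge> 2" and p: "p \<in> D"
  shows "diff_u l p = - nu1 z l p *\<^sub>R diff_u z p" "diff_v l p = - nu2 z l p *\<^sub>R diff_v z p"
proof -
  have S: "timelike_surface n D z l"
    and FM: "coeff_F z p = 0" "coeff_M z l p = 0"
    using P p by (simp_all add: principal_parameters_def)
  have D: "open D" and E: "coeff_E z p < 0" and G: "coeff_G z p > 0"
    and unit: "\<And>q. q \<in> D \<Longrightarrow> lorentz (l q) (l q) = 1"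
    and orth: "lorentz (l p) (diff_u z p) = 0" "lorentz (l p) (diff_v z p) = 0"
    using S p by (auto simp: timelike_surface_def)
  note d = timelike_surface_differentiable[OF S n p]
  note II = second_form_eq[OF S n p]
  have l: "lorentz (diff_u l p) (l p) = 0" "lorentz (diff_v l p) (l p) = 0"
    using lorentz_constant_diff[OF D p d(4) d(4) unit]
    by (simp_all add: lorentz_commute[of "l p"])
  have orth': "lorentz (diff_u z p) (diff_v z p) = 0" "lorentz (diff_v z p) (diff_u z p) = 0"
    "lorentz (diff_u z p) (l p) = 0" "lorentz (diff_v z p) (l p) = 0"
    using orth FM(1) by (simp_all add: coeff_F_def lorentz_commute)
  note basis = lorentz_orthogonal_basis_zero[of "diff_u z p" "diff_v z p" "l p"]
  have "diff_u l p + nu1 z l p *\<^sub>R diff_u z p = 0"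
    by (rule basis)
      (use E G unit[OF p] orth' FM(2) II l in \<open>auto simp: lorentz.add_left lorentz.diff_left lorentz.scaleR_left
        coeff_E_def coeff_G_def nu1_def\<close>)
  then show "diff_u l p = - nu1 z l p *\<^sub>R diff_u z p"
    by (simp add: add_eq_0_iff2)
  have "diff_v l p + nu2 z l p *\<^sub>R diff_v z p = 0"
    by (rule basis)
      (use E G unit[OF p] orth' FM(2) II l in \<open>auto simp: lorentz.add_left lorentz.diff_left lorentz.scaleR_left
        coeff_E_def coeff_G_def nu2_def\<close>)
  then show "diff_v l p = - nu2 z l p *\<^sub>R diff_v z p"
    by (simp add: add_eq_0_iff2)
qed

section \<open>Geometry of the parallel surface\<close>

lemma principal_parameters_subset:
  assumes "principal_parameters n D z l" "open D'" "D' \<subseteq> D"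
  shows "principal_parameters n D' z l"
proof -
  have "timelike_surface n D z l"
    using assms(1) by (simp add: principal_parameters_def)
  then have "class_C n D z" "class_C (n - 1) D l"
    by (simp_all add: timelike_surface_def)
  then have "class_C n D' z" "class_C (n - 1) D' l"
    using assms(3) class_C_subset by blast+
  then show ?thesis
    using assms unfolding principal_parameters_def timelike_surface_def by blast
qed

text \<open>The sign is fixed to be \<open>s\<close> on \<open>D\<close>, so the new normal is
  \<open>s\<close> times \<open>l\<close> and is differentiated without a term from the sign. One
  class of smoothness is lost, because \<open>l\<close> is only of class \<open>k\<close> when
  \<open>z\<close> is of class \<open>Suc k\<close>.\<close>

lemma parallel_surface_principal:
  assumes P: "principal_parameters (Suc k) D z l" and k: "k \<ge> 2" and s: "s \<noteq> 0"
    and sgn: "\<And>p. p \<in> D \<Longrightarrow> sgn ((1 - a * nu1 z l p) * (1 - a * nu2 z l p)) = s"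
  shows "principal_parameters k D (parallel_surface a z l) (parallel_normal a z l)" (is ?P)
    and "p \<in> D \<Longrightarrow> coeff_E (parallel_surface a z l) p = (1 - a * nu1 z l p)\<^sup>2 * coeff_E z p"
    and "p \<in> D \<Longrightarrow> coeff_G (parallel_surface a z l) p = (1 - a * nu2 z l p)\<^sup>2 * coeff_G z p"
    and "p \<in> D \<Longrightarrow> nu1 (parallel_surface a z l) (parallel_normal a z l) p
        = s * nu1 z l p / (1 - a * nu1 z l p)"
    and "p \<in> D \<Longrightarrow> nu2 (parallel_surface a z l) (parallel_normal a z l) p
        = s * nu2 z l p / (1 - a * nu2 z l p)"
proof -
  let ?z = "parallel_surface a z l" and ?l = "parallel_normal a z l"
  have S: "timelike_surface (Suc k) D z l"
    and FM: "\<And>p. p \<in> D \<Longrightarrow> coeff_F z p = 0 \<and> coeff_M z l p = 0 \<and> nu1 z l p \<noteq> nu2 z l p"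
    using P by (simp_all add: principal_parameters_def)
  have D: "open D" and z: "class_C (Suc k) D z" and l: "class_C k D l"
    and q: "\<And>p. p \<in> D \<Longrightarrow> coeff_E z p < 0 \<and> coeff_G z p > 0 \<and>
        lorentz (l p) (l p) = 1 \<and> lorentz (l p) (diff_u z p) = 0 \<and> lorentz (l p) (diff_v z p) = 0"
    using S by (simp_all add: timelike_surface_def del: class_C.simps)
  have k': "Suc k \<ge> 2"
    using k by simp
  note d = timelike_surface_differentiable[OF S k'] and W = weingarten_formulas[OF P k']
  have ln: "?l p = s *\<^sub>R l p" if "p \<in> D" for p
    using sgn[OF that] by (simp add: parallel_normal_def)
  have nz: "1 - a * nu1 z l p \<noteq> 0" "1 - a * nu2 z l p \<noteq> 0" if "p \<in> D" for p
    using sgn[OF that] s by (auto simp: sgn_mult)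
  \<comment> \<open>That \<open>s\<close> is 1 or -1 is known only through a point of
    \<open>D\<close>, hence the condition on \<open>p\<close>.\<close>
  have ss: "s * s = 1" if "p \<in> D" for p
    using sgn[OF that] s by (auto simp: sgn_if split: if_splits)
  have dz: "diff_u ?z p = (1 - a * nu1 z l p) *\<^sub>R diff_u z p"
    "diff_v ?z p = (1 - a * nu2 z l p) *\<^sub>R diff_v z p" if "p \<in> D" for p
    unfolding parallel_surface_def diff_linear[OF d(1,4)[OF that]] W[OF that]
    by (simp_all add: algebra_simps)
  have dl: "diff_u ?l p = (- s * nu1 z l p) *\<^sub>R diff_u z p"
    "diff_v ?l p = (- s * nu2 z l p) *\<^sub>R diff_v z p" if "p \<in> D" for p
    using diff_cong[OF D that ln] diff_scaleR[OF d(4)[OF that], of s] W[OF that]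
    by (simp_all add: algebra_simps)
  show EE: "coeff_E ?z p = (1 - a * nu1 z l p)\<^sup>2 * coeff_E z p" if "p \<in> D" for p
    by (simp add: coeff_E_def dz[OF that] lorentz.scaleR_left lorentz.scaleR_right power2_eq_square)
  show GG: "coeff_G ?z p = (1 - a * nu2 z l p)\<^sup>2 * coeff_G z p" if "p \<in> D" for p
    by (simp add: coeff_G_def dz[OF that] lorentz.scaleR_left lorentz.scaleR_right power2_eq_square)
  have "class_C k D ?z"
    unfolding parallel_surface_def by (rule class_C_linear[OF D class_C_Suc_imp[OF z] l])
  moreover have "class_C (k - 1) D ?l"
    by (rule class_C_cong[OF D _ class_C_scaleR[OF D class_C_mono[OF l], of _ s]]) (simp_all add: ln)
  ultimately have S': "timelike_surface k D ?z ?l"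
    unfolding timelike_surface_def using D q nz EE GG ss
    by (auto simp: ln dz lorentz.scaleR_left lorentz.scaleR_right mult_pos_neg)
  note II = second_form_eq[OF S' k]
  \<comment> \<open>The new coefficient \<open>L\<close> is
    \<open>s * nu1 * (1 - a * nu1) * E\<close>; division by the new \<open>E\<close> leaves one
    factor \<open>1 - a * nu1\<close> in the denominator.\<close>
  show N1: "nu1 ?z ?l p = s * nu1 z l p / (1 - a * nu1 z l p)" if "p \<in> D" for p
    using q[OF that] nz[OF that]
    by (simp add: nu1_def[of ?z] EE[OF that] II[OF that] dz[OF that] dl[OF that]
        lorentz.scaleR_left lorentz.scaleR_right
        lorentz.minus_left power2_eq_square flip: coeff_E_def)
  show N2: "nu2 ?z ?l p = s * nu2 z l p / (1 - a * nu2 z l p)" if "p \<in> D" for p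
    using q[OF that] nz[OF that]
    by (simp add: nu2_def[of ?z] GG[OF that] II[OF that] dz[OF that] dl[OF that]
        lorentz.scaleR_left lorentz.scaleR_right
        lorentz.minus_left power2_eq_square flip: coeff_G_def)
  have "coeff_F ?z p = 0 \<and> coeff_M ?z ?l p = 0 \<and> nu1 ?z ?l p \<noteq> nu2 ?z ?l p" if "p \<in> D" for p
  proof (intro conjI)
    have "lorentz (diff_u z p) (diff_v z p) = 0"
      using FM[OF that] by (simp add: coeff_F_def)
    then show "coeff_F ?z p = 0" "coeff_M ?z ?l p = 0"
      unfolding II(3)[OF that]
      by (simp_all add: coeff_F_def dz[OF that] dl[OF that] lorentz.scaleR_left
        lorentz.scaleR_right lorentz.minus_left)
    \<comment> \<open>After cross-multiplication the terms with \<open>nu1 * nu2\<close> cancel, and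
      the claim reduces to \<open>nu1\<close> and \<open>nu2\<close> being distinct.\<close>
    show "nu1 ?z ?l p \<noteq> nu2 ?z ?l p"
      using FM[OF that] nz[OF that] s by (simp add: N1[OF that] N2[OF that] field_simps)
  qed
  then show ?P
    using S' by (simp add: principal_parameters_def)
qed

section \<open>Functions and one-sided derivatives on intervals\<close>

text \<open>Equal values at two points would give a zero of the derivative between them by Rolle's
  theorem. Injectivity allows \<open>\<nu>\<close> to be recovered from the first principal
  curvature.\<close>

lemma nonzero_derivative_inj_on:
  fixes f :: "real \<Rightarrow> real"
  assumes I: "is_interval I" and f: "f differentiable_on I"
    and nz: "\<And>t. t \<in> I \<Longrightarrow> vector_derivative f (at t within I) \<noteq> 0"
  shows "inj_on f I"
proof (rule linorder_inj_onI)
  fix x y assume xy: "x < y" "x \<in> I" "y \<in> I"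
  have sub: "{x..y} \<subseteq> I"
    using mem_is_interval_1_I[OF I xy(2,3)] by (simp add: subset_iff)
  \<comment> \<open>Points strictly between \<open>x\<close> and \<open>y\<close> are interior to
    \<open>I\<close>, so there the derivative within \<open>I\<close> is the ordinary one.\<close>
  have diff: "f differentiable at t" "at t within I = at t" if "x < t" "t < y" for t
  proof -
    have "{x<..<y} \<subseteq> I"
      by (rule order_trans[OF greaterThanLessThan_subseteq_atLeastAtMost_iff[THEN iffD2] sub]) simp
    then have "t \<in> interior I"
      by (rule interiorI[rotated 2]) (simp_all add: that)
    then show eq: "at t within I = at t"
      by (rule at_within_interior)
    have "t \<in> I"
      using \<open>t \<in> interior I\<close> interior_subset by (rule rev_subsetD)
    then have "f differentiable (at t within I)"
      using f by (simp add: differentiable_on_def)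
    then show "f differentiable at t"
      by (simp only: eq)
  qed
  show "f x \<noteq> f y"
  proof
    assume "f x = f y"
    then obtain t where t: "x < t" "t < y" "DERIV f t :> 0"
      using Rolle[OF xy(1) _ continuous_on_subset[OF differentiable_imp_continuous_on[OF f] sub]]
        diff(1) by blast
    then have "vector_derivative f (at t within I) = 0"
      by (simp add: diff(2) has_real_derivative_iff_has_vector_derivative vector_derivative_at)
    then show False
      using nz[of t] subsetD[OF sub, of t] t(1,2) by simp
  qed
qed (rule linear)

text \<open>A connected set with more than one point has no isolated points. The nontrivial filter
  makes derivatives within the interval unique, also at end points.\<close>

lemma interval_at_within_nontrivial:
  fixes t :: real
  assumes "is_interval I" "interior I \<noteq> {}" "t \<in> I"
  shows "at t within I \<noteq> bot"
proof -
  have "t islimpt I"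
    by (rule connected_imp_perfect) (use assms in \<open>auto simp: is_interval_connected_1\<close>)
  then show ?thesis
    by (simp add: trivial_limit_within)
qed

text \<open>Derivatives taken within a component of the parallel interval thus agree with those
  within \<open>I\<close>.\<close>

lemma at_within_openin:
  assumes "openin (top_of_set I) C" "t \<in> C"
  shows "at t within C = at t within I"
proof -
  obtain T where "open T" "C = I \<inter> T"
    using assms(1) by (auto simp: openin_open)
  then show ?thesis
    using assms(2) by (intro at_within_nhd[of t T]) auto
qed

text \<open>A convex set with nonempty interior lies in the closure of that interior, so an open set
  meeting the interval meets its interior as well.\<close>

lemma interior_openin_nonempty:
  fixes I :: "real set"
  assumes "is_interval I" "interior I \<noteq> {}" "openin (top_of_set I) C" "C \<noteq> {}"
  shows "interior C \<noteq> {}"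
proof -
  obtain T where T: "open T" "C = I \<inter> T"
    using assms(3) by (auto simp: openin_open)
  have "I \<subseteq> closure (interior I)"
    using convex_closure_interior[of I] assms(1,2) closure_subset
    by (auto simp: is_interval_convex_1)
  then have "interior I \<inter> T \<noteq> {}"
    using open_Int_closure_eq_empty[OF T(1), of "interior I"] T(2) assms(4) by blast
  then show ?thesis
    using T by (simp add: interior_open)
qed

section \<open>Weingarten functions of the parallel surface and their antiderivatives\<close>

text \<open>The sign is symmetric in \<open>f\<close> and \<open>g\<close>; every result about
  \<open>parallel_f\<close> therefore carries over to \<open>parallel_g\<close> by exchanging the
  two.\<close>

lemma parallel_g_eq: "parallel_g a f g = parallel_f a g f"
proof
  show "parallel_g a f g t = parallel_f a g f t" for t
    unfolding parallel_g_def parallel_f_def parallel_sign_def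
      mult.commute[of "1 - a * f t" "1 - a * g t"] by (rule refl)
qed

text \<open>On \<open>C\<close> the sign is the constant \<open>s\<close>, and agreement on
  \<open>C\<close> suffices for a derivative within \<open>C\<close>; the rest is the quotient
  rule.\<close>

lemma parallel_f_derivative:
  assumes sgn: "\<And>t. t \<in> C \<Longrightarrow> parallel_sign a f g t = s" and "t \<in> C" "1 - a * f t \<noteq> 0"
    and f: "(f has_real_derivative f') (at t within C)"
  shows "(parallel_f a f g has_real_derivative s * f' / (1 - a * f t)\<^sup>2) (at t within C)"
proof -
  have "((\<lambda>t. s * f t / (1 - a * f t)) has_real_derivative s * f' / (1 - a * f t)\<^sup>2) (at t within C)"
    by (rule derivative_eq_intros f refl | fact assms(3))+
      (use assms(3) in \<open>simp add: field_simps power2_eq_square\<close>)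
  then show ?thesis
    by (rule has_field_derivative_transform_within[of _ _ _ _ 1]) (use assms in \<open>auto simp: parallel_f_def\<close>)
qed

lemma parallel_f_minus_parallel_g:
  assumes "1 - a * f t \<noteq> 0" "1 - a * g t \<noteq> 0"
  shows "parallel_f a f g t - parallel_g a f g t
    = parallel_sign a f g t * (f t - g t) / ((1 - a * f t) * (1 - a * g t))"
proof -
  have "parallel_sign a f g t * f t * (1 - a * g t) - parallel_sign a f g t * g t * (1 - a * f t)
      = parallel_sign a f g t * (f t - g t)"
    by (simp add: ring_distribs)
  then show ?thesis
    unfolding parallel_f_def parallel_g_def diff_frac_eq[OF assms] by (rule arg_cong)
qed

text \<open>Half the logarithm of the square stands for \<open>ln \<bar>1 - a * f t\<bar>\<close>,
  so that both signs of \<open>1 - a * f t\<close> are treated at once.\<close>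

lemma parallel_antiderivative:
  assumes sgn: "\<And>t. t \<in> C \<Longrightarrow> parallel_sign a f g t = s" and t: "t \<in> C" "at t within C \<noteq> bot"
    and nz: "1 - a * f t \<noteq> 0" "1 - a * g t \<noteq> 0" "s \<noteq> 0" "f t \<noteq> g t"
    and f: "(f has_real_derivative f') (at t within C)"
    and P: "(P has_real_derivative f' / (f t - g t)) (at t within C)"
  shows "((\<lambda>t. P t - ln ((1 - a * f t)\<^sup>2) / 2) has_real_derivative
      vector_derivative (parallel_f a f g) (at t within C) / (parallel_f a f g t - parallel_g a f g t))
      (at t within C)"
proof -
  have "vector_derivative (parallel_f a f g) (at t within C) = s * f' / (1 - a * f t)\<^sup>2"
    using parallel_f_derivative[OF sgn t(1) nz(1) f] t(2)
    by (simp add: vector_derivative_within has_real_derivative_iff_has_vector_derivative)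
  moreover have "parallel_f a f g t - parallel_g a f g t
      = s * (f t - g t) / ((1 - a * f t) * (1 - a * g t))"
    using sgn[OF t(1)] nz(1,2) by (simp add: parallel_f_minus_parallel_g)
  ultimately have "vector_derivative (parallel_f a f g) (at t within C)
      / (parallel_f a f g t - parallel_g a f g t) = f' * (1 - a * g t) / ((f t - g t) * (1 - a * f t))"
    using nz by (simp add: power2_eq_square)
  \<comment> \<open>Partial fractions, from
    \<open>1 - a * g t = (1 - a * f t) + a * (f t - g t)\<close>.\<close>
  also have "\<dots> = f' / (f t - g t) + a * f' / (1 - a * f t)"
    using nz by (simp add: divide_simps) (simp add: algebra_simps)
  also have "\<dots> = f' / (f t - g t) - (- (2 * a * f' * (1 - a * f t)) / (1 - a * f t)\<^sup>2) / 2"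
    using nz by (simp add: power2_eq_square divide_simps) (simp add: algebra_simps)
  finally have eq: "vector_derivative (parallel_f a f g) (at t within C)
      / (parallel_f a f g t - parallel_g a f g t) = \<dots>" .
  have d: "((\<lambda>t. (1 - a * f t)\<^sup>2) has_real_derivative - (2 * a * f' * (1 - a * f t))) (at t within C)"
    by (rule derivative_eq_intros f refl)+ simp
  have "((\<lambda>t. ln ((1 - a * f t)\<^sup>2)) has_real_derivative
      - (2 * a * f' * (1 - a * f t)) / (1 - a * f t)\<^sup>2) (at t within C)"
    using DERIV_chain2[OF DERIV_ln_divide d] nz(1) by simp
  then show ?thesis
    unfolding eq by (intro DERIV_diff DERIV_cdivide P)
qed

text \<open>The root yields the factor \<open>\<bar>c\<bar>\<close> and the exponential its inverse.
  Here \<open>c\<close> will be \<open>1 - a * f t\<close> or \<open>1 - a * g t\<close>.\<close>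

lemma sqrt_times_exp_minus_ln:
  assumes "c \<noteq> 0"
  shows "sqrt (c\<^sup>2 * e) * exp (x - ln (c\<^sup>2) / 2) = sqrt e * exp x"
proof -
  have "exp (ln (c\<^sup>2) / 2) = \<bar>c\<bar>"
    using assms by (simp add: ln_sqrt[symmetric])
  then show ?thesis
    using assms by (simp add: exp_diff real_sqrt_mult)
qed

section \<open>Continuity of the parameter and constancy of the sign\<close>

text \<open>Since \<open>f\<close> is a homeomorphism onto its image, \<open>\<nu>\<close> inherits the continuity of the first
  principal curvature.\<close>

lemma weingarten_parameter_continuous:
  assumes W: "weingarten_surface n D z l I f g \<nu>" and n: "n \<ge> 2"
  shows "continuous_on D \<nu>"
proof -
  have S: "timelike_surface n D z l" and I: "is_interval I" and f: "f differentiable_on I"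
    and nz: "\<And>t. t \<in> I \<Longrightarrow> vector_derivative f (at t within I) \<noteq> 0"
    and \<nu>: "\<And>p. p \<in> D \<Longrightarrow> \<nu> p \<in> I" "\<And>p. p \<in> D \<Longrightarrow> nu1 z l p = f (\<nu> p)"
    using W by (auto simp: weingarten_surface_def principal_parameters_def)
  have E: "\<And>p. p \<in> D \<Longrightarrow> coeff_E z p \<noteq> 0"
    and "class_C (Suc (Suc 0)) D z" and l: "continuous_on D l"
    using S n class_C_mono[of n D z "Suc (Suc 0)"] class_C_continuous[of "n - 1" D l]
    by (auto simp: timelike_surface_def simp del: class_C.simps)
  then have "continuous_on D (diff_u z)" "continuous_on D (diff_u (diff_u z))"
    using class_C_continuous[of "Suc 0" D "diff_u z"] by simp_all
  then have nu1: "continuous_on D (nu1 z l)"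
    unfolding nu1_def[abs_def] coeff_L_def coeff_E_def using E l
    by (intro continuous_on_divide lorentz.continuous_on) (auto simp: coeff_E_def)
  \<comment> \<open>A continuous injection on an interval has a continuous inverse \<open>h\<close>,
    and \<open>\<nu>\<close> is \<open>h\<close> applied to the first principal curvature.\<close>
  obtain h where "homeomorphism I (f ` I) f h"
    using injective_into_1d_eq_homeomorphism[OF differentiable_imp_continuous_on[OF f]]
      nonzero_derivative_inj_on[OF I f nz] I is_interval_path_connected by blast
  then have h: "continuous_on (f ` I) h" "\<And>t. t \<in> I \<Longrightarrow> h (f t) = t"
    by (simp_all add: homeomorphism_def)
  have "continuous_on D (\<lambda>p. h (nu1 z l p))"
    by (rule continuous_on_compose2[OF h(1) nu1]) (simp add: \<nu> image_subset_iff)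
  then show ?thesis
    by (rule continuous_on_eq) (simp add: h(2) \<nu>)
qed

text \<open>Two values of different sign would force the connected image to contain zero.\<close>

lemma sgn_constant_on_connected:
  fixes w :: "'a::topological_space \<Rightarrow> real"
  assumes "connected C" "continuous_on C w" "\<And>t. t \<in> C \<Longrightarrow> w t \<noteq> 0" "x \<in> C" "y \<in> C"
  shows "sgn (w x) = sgn (w y)"
proof (rule ccontr)
  assume "sgn (w x) \<noteq> sgn (w y)"
  then have "w x \<le> 0 \<and> 0 \<le> w y \<or> w y \<le> 0 \<and> 0 \<le> w x"
    by (auto simp: sgn_if split: if_splits)
  moreover have "connected (w ` C)"
    using assms(1,2) by (simp add: connected_continuous_image)
  ultimately have "0 \<in> w ` C"
    using assms(4,5) connected_contains_Icc[of "w ` C"] by (meson atLeastAtMost_iff imageI subsetD)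
  then show False
    using assms(3) by auto
qed

section \<open>Natural principal parameters over each component of the parallel interval\<close>

theorem proposition4p1:
  fixes z l :: "real \<times> real \<Rightarrow> real^3" and D :: "(real \<times> real) set"
    and I :: "real set" and f g :: "real \<Rightarrow> real" and \<nu> :: "real \<times> real \<Rightarrow> real"
    and k :: nat
  assumes "k \<ge> 2"
    and "natural_principal_parameters (Suc k) D z l I f g \<nu>"
  shows "\<forall>a. a \<noteq> 0 \<longrightarrow>
    (\<forall>C \<in> components (parallel_interval a I f g).
      natural_principal_parameters k {p \<in> parallel_domain a D z l. \<nu> p \<in> C}
        (parallel_surface a z l) (parallel_normal a z l)
        C (parallel_f a f g) (parallel_g a f g) \<nu>)"
proof (intro allI impI ballI)
  fix a C
  assume C: "C \<in> components (parallel_interval a I f g)"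
  let ?w = "\<lambda>t. (1 - a * f t) * (1 - a * g t)"
  define D' where "D' = {p \<in> parallel_domain a D z l. \<nu> p \<in> C}"
  obtain P Q where
    W: "weingarten_surface (Suc k) D z l I f g \<nu>"
    and P: "\<And>t. t \<in> I \<Longrightarrow>
      (P has_real_derivative vector_derivative f (at t within I) / (f t - g t)) (at t within I)"
    and Q: "\<And>t. t \<in> I \<Longrightarrow>
      (Q has_real_derivative vector_derivative g (at t within I) / (g t - f t)) (at t within I)"
    and const: "(\<lambda>p. sqrt (- coeff_E z p) * exp (P (\<nu> p))) constant_on D"
      "(\<lambda>p. sqrt (coeff_G z p) * exp (Q (\<nu> p))) constant_on D"
    using assms(2) unfolding natural_principal_parameters_def by blast
  have PP: "principal_parameters (Suc k) D z l"
    and I: "is_interval I" "interior I \<noteq> {}"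
    and fg: "f differentiable_on I" "g differentiable_on I"
    and nz: "\<And>t. t \<in> I \<Longrightarrow> f t \<noteq> g t" "\<And>t. t \<in> I \<Longrightarrow> vector_derivative f (at t within I) \<noteq> 0"
      "\<And>t. t \<in> I \<Longrightarrow> vector_derivative g (at t within I) \<noteq> 0"
    and \<nu>: "\<And>p. p \<in> D \<Longrightarrow> \<nu> p \<in> I" "\<And>p. p \<in> D \<Longrightarrow> nu1 z l p = f (\<nu> p)"
      "\<And>p. p \<in> D \<Longrightarrow> nu2 z l p = g (\<nu> p)"
    using W by (auto simp: weingarten_surface_def)
  have S: "timelike_surface (Suc k) D z l"
    using PP by (simp add: principal_parameters_def)
  then have D: "open D"
    by (simp add: timelike_surface_def)
  have cont: "continuous_on I f" "continuous_on I g"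
    using fg by (auto intro: differentiable_imp_continuous_on)

  \<comment> \<open>The definition of a Weingarten surface does not ask \<open>\<nu>\<close> to be
    continuous; continuity is what makes \<open>D'\<close> open.\<close>
  have cont_\<nu>: "continuous_on D \<nu>"
    by (rule weingarten_parameter_continuous[OF W]) (use assms(1) in simp)

  have "openin (top_of_set I) (I \<inter> ?w -` (- {0}))"
    by (intro continuous_openin_preimage_gen continuous_intros cont)
  then have J: "openin (top_of_set I) (parallel_interval a I f g)"
    by (simp add: parallel_interval_def vimage_def Int_def)
  \<comment> \<open>Components of a relatively open subset of a locally connected set are relatively
    open, so \<open>C\<close> is a nondegenerate interval on which limits within \<open>C\<close>
    and within \<open>I\<close> agree.\<close>
  have "locally connected I"
    using I(1) by (simp add: convex_imp_locally_connected is_interval_convex_1)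
  then have "locally connected (parallel_interval a I f g)"
    by (rule locally_open_subset[OF _ J])
  then have "openin (top_of_set (parallel_interval a I f g)) C"
    by (rule openin_components_locally_connected[OF _ C])
  then have openC: "openin (top_of_set I) C"
    using J openin_trans by blast
  have connC: "connected C" and neC: "C \<noteq> {}" and subC: "C \<subseteq> parallel_interval a I f g"
    using C in_components_connected in_components_nonempty in_components_subset by blast+
  have C': "is_interval C" "interior C \<noteq> {}" "C \<subseteq> I"
    using connC interior_openin_nonempty[OF I openC neC] openin_imp_subset[OF openC]
    by (auto simp: is_interval_connected_1)
  have w: "1 - a * f t \<noteq> 0" "1 - a * g t \<noteq> 0" if "t \<in> C" for t
    using subC that by (auto simp: parallel_interval_def)
  have at: "at t within C = at t within I" "at t within C \<noteq> bot" if "t \<in> C" for t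
    using at_within_openin[OF openC that] interval_at_within_nontrivial[OF C'(1,2) that] by auto

  \<comment> \<open>The continuous function \<open>?w\<close> has no zero on the connected set
    \<open>C\<close>, so one sign serves for the whole component.\<close>
  obtain s where s: "s \<noteq> 0" "\<And>t. t \<in> C \<Longrightarrow> parallel_sign a f g t = s"
  proof -
    obtain c where c: "c \<in> C"
      using neC by auto
    have "continuous_on C ?w"
      by (intro continuous_intros continuous_on_subset[OF _ C'(3)] cont)
    then have "parallel_sign a f g t = parallel_sign a f g c" if "t \<in> C" for t
      unfolding parallel_sign_def using w c that by (intro sgn_constant_on_connected[OF connC]) auto
    then show ?thesis
      using that[of "parallel_sign a f g c"] w[OF c] by (simp add: parallel_sign_def sgn_eq_0_iff)
  qed

  \<comment> \<open>Membership of \<open>\<nu> p\<close> in \<open>C\<close> already excludes the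
    singular points, so \<open>D'\<close> is simply a preimage of \<open>C\<close>.\<close>
  have D'_eq: "D' = D \<inter> \<nu> -` C"
  proof -
    have "p \<in> parallel_domain a D z l" if "p \<in> D" "\<nu> p \<in> C" for p
      using w[OF that(2)] that(1) by (simp add: parallel_domain_def \<nu>)
    then show ?thesis
      by (auto simp: D'_def parallel_domain_def)
  qed
  have "openin (top_of_set D) D'"
    unfolding D'_eq using cont_\<nu> \<nu>(1) openC by (intro continuous_openin_preimage) auto
  then have D': "open D'" "D' \<subseteq> D" and \<nu>C: "\<And>p. p \<in> D' \<Longrightarrow> \<nu> p \<in> C"
    using D openin_open_trans by (auto simp: D'_eq)
  have PD: "p \<in> D" if "p \<in> D'" for p
    using that D' by auto
  have "principal_parameters (Suc k) D' z l"
    by (rule principal_parameters_subset[OF PP D'])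
  moreover have "sgn ((1 - a * nu1 z l p) * (1 - a * nu2 z l p)) = s" if "p \<in> D'" for p
    using s(2)[OF \<nu>C[OF that]] PD[OF that] by (simp add: parallel_sign_def \<nu>)
  ultimately have bar: "principal_parameters k D' (parallel_surface a z l) (parallel_normal a z l)"
    "\<And>p. p \<in> D' \<Longrightarrow> coeff_E (parallel_surface a z l) p = (1 - a * f (\<nu> p))\<^sup>2 * coeff_E z p"
    "\<And>p. p \<in> D' \<Longrightarrow> coeff_G (parallel_surface a z l) p = (1 - a * g (\<nu> p))\<^sup>2 * coeff_G z p"
    "\<And>p. p \<in> D' \<Longrightarrow> nu1 (parallel_surface a z l) (parallel_normal a z l) p = parallel_f a f g (\<nu> p)"
    "\<And>p. p \<in> D' \<Longrightarrow> nu2 (parallel_surface a z l) (parallel_normal a z l) p = parallel_g a f g (\<nu> p)"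
    using parallel_surface_principal[of k D' z l s a] assms(1) s \<nu>C PD
    by (simp_all add: \<nu> parallel_f_def parallel_g_def)

  \<comment> \<open>The sign with \<open>f\<close> and \<open>g\<close> exchanged, as needed to
    apply the lemmas on \<open>parallel_f\<close> to \<open>parallel_g\<close>.\<close>
  have s': "\<And>t. t \<in> C \<Longrightarrow> parallel_sign a g f t = s"
    using s(2) by (simp add: parallel_sign_def mult.commute)
  have deriv: "(f has_real_derivative vector_derivative f (at t within I)) (at t within C)"
    "(g has_real_derivative vector_derivative g (at t within I)) (at t within C)"
    "f t \<noteq> g t" "g t \<noteq> f t" if "t \<in> C" for t
  proof -
    have "t \<in> I"
      using that C'(3) by auto
    then show "(f has_real_derivative vector_derivative f (at t within I)) (at t within C)"
      "(g has_real_derivative vector_derivative g (at t within I)) (at t within C)"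
      "f t \<noteq> g t" "g t \<noteq> f t"
      using fg nz(1)[of t] unfolding at(1)[OF that] differentiable_on_def
      by (auto simp: has_real_derivative_iff_has_vector_derivative vector_derivative_works[symmetric])
  qed
  have antideriv:
    "(P has_real_derivative vector_derivative f (at t within I) / (f t - g t)) (at t within C)"
    "(Q has_real_derivative vector_derivative g (at t within I) / (g t - f t)) (at t within C)"
    if "t \<in> C" for t
    using P[of t] Q[of t] that C'(3) unfolding at(1)[OF that] by auto
  have deriv_bar: "(parallel_f a f g has_real_derivative
        s * vector_derivative f (at t within I) / (1 - a * f t)\<^sup>2) (at t within C)"
    "(parallel_g a f g has_real_derivative
        s * vector_derivative g (at t within I) / (1 - a * g t)\<^sup>2) (at t within C)" if "t \<in> C" for t
    unfolding parallel_g_eq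
    using parallel_f_derivative[OF s(2) that w(1)[OF that] deriv(1)[OF that]]
      parallel_f_derivative[OF s' that w(2)[OF that] deriv(2)[OF that]] by simp_all
  have "parallel_f a f g differentiable_on C" "parallel_g a f g differentiable_on C"
    unfolding differentiable_on_def using deriv_bar
    by (blast intro: differentiableI has_field_derivative_imp_has_derivative)+
  moreover have "vector_derivative (parallel_f a f g) (at t within C)
      * vector_derivative (parallel_g a f g) (at t within C) \<noteq> 0" if "t \<in> C" for t
    using deriv_bar[OF that] at(2)[OF that] nz(2,3)[of t] that C'(3) w[OF that] s(1)
    by (auto simp: vector_derivative_within has_real_derivative_iff_has_vector_derivative)
  moreover have "parallel_f a f g t - parallel_g a f g t \<noteq> 0" if "t \<in> C" for t
    using w[OF that] deriv(3)[OF that] s(1) by (simp add: parallel_f_minus_parallel_g s(2)[OF that])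
  ultimately have "weingarten_surface k D' (parallel_surface a z l) (parallel_normal a z l)
      C (parallel_f a f g) (parallel_g a f g) \<nu>"
    using bar C' \<nu>C by (auto simp: weingarten_surface_def)
  moreover have "((\<lambda>t. P t - ln ((1 - a * f t)\<^sup>2) / 2) has_real_derivative
      vector_derivative (parallel_f a f g) (at t within C) / (parallel_f a f g t - parallel_g a f g t))
      (at t within C)" if "t \<in> C" for t
    by (rule parallel_antiderivative[OF s(2) that at(2) w s(1) deriv(3,1) antideriv(1)]) (simp_all add: that)
  moreover have "((\<lambda>t. Q t - ln ((1 - a * g t)\<^sup>2) / 2) has_real_derivative
      vector_derivative (parallel_g a f g) (at t within C) / (parallel_g a f g t - parallel_f a f g t))
      (at t within C)" if "t \<in> C" for t
    \<comment> \<open>The two rewrites turn the claim into the one for \<open>f\<close> with the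
      roles of \<open>f\<close> and \<open>g\<close> exchanged.\<close>
    unfolding parallel_g_eq[of a f g] parallel_g_eq[of a g f, symmetric]
    by (rule parallel_antiderivative[OF s' that at(2) w(2,1) s(1) deriv(4,2) antideriv(2)]) (simp_all add: that)
  \<comment> \<open>On \<open>D'\<close> the function coincides with the one for the original
    surface, so even the constant is unchanged.\<close>
  moreover have "(\<lambda>p. sqrt (- coeff_E (parallel_surface a z l) p)
      * exp (P (\<nu> p) - ln ((1 - a * f (\<nu> p))\<^sup>2) / 2)) constant_on D'"
    using const(1) bar(2) PD sqrt_times_exp_minus_ln[OF w(1)[OF \<nu>C]]
    unfolding constant_on_def by (metis mult_minus_right)
  moreover have "(\<lambda>p. sqrt (coeff_G (parallel_surface a z l) p)
      * exp (Q (\<nu> p) - ln ((1 - a * g (\<nu> p))\<^sup>2) / 2)) constant_on D'"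
    using const(2) bar(3) PD sqrt_times_exp_minus_ln[OF w(2)[OF \<nu>C]]
    unfolding constant_on_def by metis
  ultimately show "natural_principal_parameters k {p \<in> parallel_domain a D z l. \<nu> p \<in> C}
      (parallel_surface a z l) (parallel_normal a z l) C (parallel_f a f g) (parallel_g a f g) \<nu>"
    unfolding natural_principal_parameters_def D'_def[symmetric] by blast
qed

end
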